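(* Let $N$ be a positive integer and let $\alpha,\beta,\zeta$ be real parameters that are generic (no denominator appearing in the formulas below or in the context vanishes). Write $\mathcal U_m(n)=\mathcal U_m(n;\alpha,\beta,\zeta,N)$ and $\widetilde{\mathcal U}_m(n)=\widetilde{\mathcal U}_m(n;\alpha,\beta,\zeta,N)$ for the rational functions defined in the context. Then for all $m,n\in\{0,\dots,N\}$ $$\sum_{j=0}^N \mathcal W(j)\,\widetilde{\mathcal U}_m(j)\,\mathcal U_n(j)=h_n\,\delta_{n,m},\qquad \sum_{j=0}^N \mathcal W^*(j)\,\widetilde{\mathcal U}_j(m)\,\mathcal U_j(n)=h_n^*\,\delta_{n,m},$$ where $$h_n=\frac{n!\,(N-2\beta-2\zeta)_n}{(-N)_n\,(2n-1-2\beta-2\zeta)\,(-2\beta-2\zeta)_{n-1}},$$ $$\mathcal W(j)=\frac{(-N,\,1-\alpha+\beta,\,N-2\alpha-\beta-2\zeta)_j\,(2\alpha-\beta-N,\,\alpha+\beta-N+2\zeta)_{N-j}}{j!\,(-\alpha,\,-2\beta-2\zeta)_N},$$ $$h_n^*=\frac{(1,\,1-2\alpha+\beta,\,1-\alpha-\beta-2\zeta)_n}{(-N,\,1-\alpha+\beta,\,N-2\alpha-\beta-2\zeta)_n},$$ $$\mathcal W^*(j)=\frac{(-N)_j}{j!}\,\frac{2j-1-2\beta-2\zeta}{(j-1-2\beta-2\zeta)_{N+1}}\,\frac{(1-2\alpha+\beta,\,1-\alpha-\beta-2\zeta)_N}{(-\alpha)_N}.$$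
   Context: Notation: $(a)_n=a(a+1)\cdots(a+n-1)$ for $n\ge1$, $(a)_0=1$, $(a)_{-1}=1/(a-1)$, and $(a_1,\dots,a_k)_n=(a_1)_n\cdots(a_k)_n$. For $m,n\in\{0,\dots,N\}$, $$\mathcal U_m(n;a,b,c,N)={}_4F_3\left({-m,\ -n,\ -a,\ m-2b-2c-1\atop -N,\ a-b-n,\ N-2a-b-2c};1\right)=\sum_{\ell=0}^{\min(m,n)}\frac{(-m,-n,-a,m-2b-2c-1)_\ell}{\ell!\,(-N,a-b-n,N-2a-b-2c)_\ell},$$ $$\widetilde{\mathcal U}_m(n;a,b,c,N)=\mathcal U_m(N-n;\,N-a-1,\,b+2c-2,\,2-c,\,N).$$ *)

theory Defs
  imports Complex_Main
begin

text \<open>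
  \<open>(a)\<^sub>k\<close> for integers \<open>k \<ge> -1\<close>, with \<open>(a)\<^sub>-\<^sub>1 = 1 / (a - 1)\<close>; values at \<open>k < -1\<close> are never used.
\<close>

definition rising :: "real \<Rightarrow> int \<Rightarrow> real" where
  "rising a k = (if k = -1 then 1 / (a - 1) else pochhammer a (nat k))"

text \<open>\<open>pochs [a\<^sub>1, \<dots>, a\<^sub>k] n\<close> is \<open>(a\<^sub>1, \<dots>, a\<^sub>k)\<^sub>n\<close>.\<close>

definition pochs :: "real list \<Rightarrow> nat \<Rightarrow> real" where
  "pochs as n = (\<Prod>a\<leftarrow>as. pochhammer a n)"

text \<open>
  The functions \<open>\<U>\<^sub>m(n; a, b, c, N)\<close>: the terminating hypergeometric series
  \<open>\<^sub>4F\<^sub>3(-m, -n, -a, m-2b-2c-1; -N, a-b-n, N-2a-b-2c; 1)\<close>, cut off at \<open>min m n\<close>, where its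
  numerator vanishes.  The sum is meant for \<open>m, n \<le> N\<close>, for which \<open>(-N)\<^sub>l \<noteq> 0\<close> in every term.
\<close>

definition Ulower :: "nat \<Rightarrow> real \<Rightarrow> real \<Rightarrow> real \<Rightarrow> nat \<Rightarrow> real list" where
  "Ulower n a b c N = [- real N, a - b - real n, real N - 2 * a - b - 2 * c]"

definition Ufun :: "nat \<Rightarrow> nat \<Rightarrow> real \<Rightarrow> real \<Rightarrow> real \<Rightarrow> nat \<Rightarrow> real" where
  "Ufun m n a b c N =
     (\<Sum>l\<le>min m n. pochs [- real m, - real n, - a, real m - 2 * b - 2 * c - 1] l
        / (fact l * pochs (Ulower n a b c N) l))"

definition Utilde :: "nat \<Rightarrow> nat \<Rightarrow> real \<Rightarrow> real \<Rightarrow> real \<Rightarrow> nat \<Rightarrow> real" where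
  "Utilde m n a b c N = Ufun m (N - n) (real N - a - 1) (b + 2 * c - 2) (2 - c) N"

definition U_denoms_nonzero :: "real \<Rightarrow> real \<Rightarrow> real \<Rightarrow> nat \<Rightarrow> bool" where
  "U_denoms_nonzero a b c N \<longleftrightarrow>
     (\<forall>m\<le>N. \<forall>n\<le>N. \<forall>l\<le>min m n. pochs (Ulower n a b c N) l \<noteq> 0)"

definition norm_h :: "real \<Rightarrow> real \<Rightarrow> real \<Rightarrow> nat \<Rightarrow> nat \<Rightarrow> real" where
  "norm_h \<alpha> \<beta> \<zeta> N n =
     fact n * pochhammer (real N - 2 * \<beta> - 2 * \<zeta>) n
     / (pochhammer (- real N) n * (2 * real n - 1 - 2 * \<beta> - 2 * \<zeta>)
        * rising (- 2 * \<beta> - 2 * \<zeta>) (int n - 1))"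

definition weight_W :: "real \<Rightarrow> real \<Rightarrow> real \<Rightarrow> nat \<Rightarrow> nat \<Rightarrow> real" where
  "weight_W \<alpha> \<beta> \<zeta> N j =
     pochs [- real N, 1 - \<alpha> + \<beta>, real N - 2 * \<alpha> - \<beta> - 2 * \<zeta>] j
     * pochs [2 * \<alpha> - \<beta> - real N, \<alpha> + \<beta> - real N + 2 * \<zeta>] (N - j)
     / (fact j * pochs [- \<alpha>, - 2 * \<beta> - 2 * \<zeta>] N)"

definition norm_h_star :: "real \<Rightarrow> real \<Rightarrow> real \<Rightarrow> nat \<Rightarrow> nat \<Rightarrow> real" where
  "norm_h_star \<alpha> \<beta> \<zeta> N n =
     pochs [1, 1 - 2 * \<alpha> + \<beta>, 1 - \<alpha> - \<beta> - 2 * \<zeta>] n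
     / pochs [- real N, 1 - \<alpha> + \<beta>, real N - 2 * \<alpha> - \<beta> - 2 * \<zeta>] n"

definition weight_W_star :: "real \<Rightarrow> real \<Rightarrow> real \<Rightarrow> nat \<Rightarrow> nat \<Rightarrow> real" where
  "weight_W_star \<alpha> \<beta> \<zeta> N j =
     pochhammer (- real N) j / fact j
     * ((2 * real j - 1 - 2 * \<beta> - 2 * \<zeta>)
        / pochhammer (real j - 1 - 2 * \<beta> - 2 * \<zeta>) (N + 1))
     * (pochs [1 - 2 * \<alpha> + \<beta>, 1 - \<alpha> - \<beta> - 2 * \<zeta>] N / pochhammer (- \<alpha>) N)"

text \<open>
  Genericity is exactly the non-vanishing of the parameter-dependent denominators: those of
  \<open>\<U>\<close>, of \<open>\<U>\<close> at the shifted parameters defining \<open>Utilde\<close>, and then, line by line, of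
  \<open>h\<^sub>n\<close>, \<open>W\<close>, \<open>h\<^sub>n\<^sup>*\<close> and \<open>W\<^sup>*\<close>.  At \<open>n = 0\<close> the \<open>rising\<close> factor being nonzero includes
  \<open>-2\<beta>-2\<zeta>-1 \<noteq> 0\<close>, the denominator of \<open>(-2\<beta>-2\<zeta>)\<^sub>-\<^sub>1\<close>, because \<open>1 / 0 = 0\<close>.
\<close>

definition generic :: "real \<Rightarrow> real \<Rightarrow> real \<Rightarrow> nat \<Rightarrow> bool" where
  "generic \<alpha> \<beta> \<zeta> N \<longleftrightarrow>
     U_denoms_nonzero \<alpha> \<beta> \<zeta> N \<and>
     U_denoms_nonzero (real N - \<alpha> - 1) (\<beta> + 2 * \<zeta> - 2) (2 - \<zeta>) N \<and>
     (\<forall>n\<le>N. (2 * real n - 1 - 2 * \<beta> - 2 * \<zeta>) * rising (- 2 * \<beta> - 2 * \<zeta>) (int n - 1) \<noteq> 0) \<and>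
     pochs [- \<alpha>, - 2 * \<beta> - 2 * \<zeta>] N \<noteq> 0 \<and>
     (\<forall>n\<le>N. pochs [- real N, 1 - \<alpha> + \<beta>, real N - 2 * \<alpha> - \<beta> - 2 * \<zeta>] n \<noteq> 0) \<and>
     (\<forall>j\<le>N. pochhammer (real j - 1 - 2 * \<beta> - 2 * \<zeta>) (N + 1) \<noteq> 0) \<and>
     pochhammer (- \<alpha>) N \<noteq> 0"

end

theory Submission
  imports Defs "Jordan_Normal_Form.Determinant"
begin

text \<open>
  Everything rests on the Pfaff--Saalschuetz summation of a terminating balanced
  \<open>\<^sub>3F\<^sub>2(1)\<close>, used twice.

  Put \<open>a = \<alpha>\<close>, \<open>u = \<alpha> - \<beta>\<close>, \<open>t = -2\<beta> - 2\<zeta> - 1\<close>, \<open>v = t + 2 - u\<close>, \<open>e = N + 1 + t - u - a\<close> and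
  \<open>f = a + u - N\<close>.  Then \<open>\<U>\<^sub>n(j)\<close> is a combination of the functions
  \<open>\<phi>\<^sub>l(j) = (-j)\<^sub>l / (u-j)\<^sub>l\<close>, and its partner is one of \<open>\<psi>\<^sub>k(j) = (j-N)\<^sub>k / (v+j)\<^sub>k\<close>.  Up to a factor
  \<open>c\<close> that does not depend on \<open>j\<close>, the weight is
  \<open>w(j) = (-N, 1-u, e)\<^sub>j / (j! (1-a-u, v)\<^sub>j)\<close>.  Multiplying \<open>w\<close> by \<open>\<phi>\<^sub>l\<close> and \<open>\<psi>\<^sub>k\<close> only shifts its
  parameters and keeps the series balanced, so every moment \<open>\<Sum>\<^sub>j w \<phi>\<^sub>l \<psi>\<^sub>k\<close> is a product
  (\<open>moment\<close>).  In this product the parts that involve \<open>a\<close> and \<open>u\<close> depend on \<open>l\<close> alone or on \<open>k\<close>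
  alone and are exactly cancelled by the coefficients of \<open>\<U>\<close> and its partner.  What is left
  is a bilinear form \<open>S\<close> in the coefficients of two Hahn-type polynomials, with the Hankel moments
  \<open>(-N)\<^sub>l\<^sub>+\<^sub>k / (t+1)\<^sub>l\<^sub>+\<^sub>k\<close>.  Its inner sum is again balanced (\<open>S_inner\<close>) and contains the factor
  \<open>(l+1-m)\<^sub>m\<close>, which vanishes for \<open>l < m\<close>.  Hence \<open>S\<close> is triangular; being symmetric, it is
  diagonal.

  The first relation says that two square matrices, suitably scaled, are inverse to each other.
  The second relation is the product in the other order (\<open>transpose_biorthogonality\<close>), because
  \<open>W\<^sup>*(j) = c / h\<^sub>j\<close> and \<open>h\<^sub>n\<^sup>* = 1 / w(n)\<close>.
\<close>

section \<open>The Pfaff--Saalschuetz summation\<close>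

text \<open>
  Clearing denominators makes the summation a polynomial identity, valid in every commutative
  ring and free of side conditions.  The right-hand side gains the factor \<open>K\<close> when \<open>n\<close>
  grows by one; Zeilberger's method supplies the certificate \<open>R\<close> by which the summands obey the
  same recurrence up to a telescoping difference.
\<close>

lemma saalschuetz_product:
  fixes a b c :: "'a::comm_ring_1"
  shows "(\<Sum>k\<le>n. of_nat (n choose k) * pochhammer a k * pochhammer b k
             * pochhammer (c + of_nat k) (n - k) * pochhammer (c - a - b) (n - k))
         = pochhammer (c - a) n * pochhammer (c - b) n"
proof (induction n)
  case 0
  then show ?case by simp
next
  case (Suc n)
  define s where "s m k = of_nat (m choose k) * pochhammer a k * pochhammer b k
      * pochhammer (c + of_nat k) (m - k) * pochhammer (c - a - b) (m - k)" for m k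
  define p where "p k = pochhammer a k * pochhammer b k
      * pochhammer (c + of_nat k) (n - k) * pochhammer (c - a - b) (n - k)" for k
  define K where "K = (c - a + of_nat n) * (c - b + of_nat n)"
  define R where "R k = (case k of 0 \<Rightarrow> 0
      | Suc i \<Rightarrow> - of_nat (n choose i) * p i * (a + of_nat i) * (b + of_nat i))" for k
  have step: "s (Suc n) k - K * s n k = R (Suc k) - R k" if "k \<le> n" for k
  proof -
    from that obtain d where n: "n = k + d" using le_Suc_ex by blast
    have s_Suc: "s (Suc n) k
        = of_nat (Suc n choose k) * p k * (c + of_nat n) * (c - a - b + of_nat d)"
      by (simp add: s_def p_def n Suc_diff_le pochhammer_Suc algebra_simps)
    have s_n: "s n k = of_nat (n choose k) * p k"
      by (simp add: s_def p_def algebra_simps)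
    show ?thesis
    proof (cases k)
      case 0
      then show ?thesis
        unfolding s_Suc s_n K_def R_def by (simp add: n algebra_simps)
    next
      case (Suc i)
      have shift: "p i * (a + of_nat i) * (b + of_nat i)
          = p k * (c + of_nat i) * (c - a - b + of_nat d)"
      proof -
        have n_i: "n - i = Suc d" "n - k = d" by (simp_all add: n Suc)
        have c: "pochhammer (c + of_nat i) (Suc d)
            = (c + of_nat i) * pochhammer (c + of_nat k) d"
          by (simp add: pochhammer_rec Suc add_ac)
        show ?thesis
          unfolding p_def n_i c by (simp add: Suc pochhammer_Suc mult_ac)
      qed
      have "(n choose i) * (d + 1) = (n choose k) * k"
        unfolding n Suc
        by (metis Suc_eq_plus1 Suc_times_binomial_add add.commute add_Suc_right mult.commute)
      then have absorb: "of_nat (n choose i) * (of_nat d + 1) = (of_nat (n choose k) * of_nat k :: 'a)"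
        by (metis of_nat_1 of_nat_add of_nat_mult)
      have pascal: "of_nat (Suc n choose k) = (of_nat (n choose i) + of_nat (n choose k) :: 'a)"
        by (simp add: Suc)
      have i: "of_nat i = (of_nat k - 1 :: 'a)" and nn: "of_nat n = (of_nat k + of_nat d :: 'a)"
        by (simp_all add: n Suc)
      have R: "R (Suc k) - R k = - of_nat (n choose k) * p k * (a + of_nat k) * (b + of_nat k)
          + of_nat (n choose i) * (p k * (c + of_nat i) * (c - a - b + of_nat d))"
        unfolding shift[symmetric] by (simp add: R_def Suc algebra_simps)
      have "s (Suc n) k - K * s n k - (R (Suc k) - R k)
          = p k * (c - a - b + of_nat d)
            * (of_nat (n choose i) * (of_nat d + 1) - of_nat (n choose k) * of_nat k)"
        unfolding s_Suc s_n K_def R pascal i nn by (simp add: algebra_simps)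
      then show ?thesis
        by (simp add: absorb)
    qed
  qed
  have s_last: "s (Suc n) (Suc n) = - R (Suc n)"
    by (simp add: s_def R_def p_def pochhammer_Suc algebra_simps)
  have "(\<Sum>k\<le>Suc n. s (Suc n) k) - K * (\<Sum>k\<le>n. s n k)
      = (\<Sum>k\<le>n. s (Suc n) k - K * s n k) - R (Suc n)"
    by (simp add: s_last sum_subtractf sum_distrib_left)
  also have "\<dots> = (\<Sum>k<Suc n. R (Suc k) - R k) - R (Suc n)"
    using step by (simp add: lessThan_Suc_atMost)
  also have "\<dots> = 0"
    by (subst sum_lessThan_telescope) (simp add: R_def)
  finally have "(\<Sum>k\<le>Suc n. s (Suc n) k) = K * (\<Sum>k\<le>n. s n k)"
    by simp
  with Suc.IH show ?case
    by (simp add: s_def K_def pochhammer_Suc algebra_simps)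
qed

lemma pochhammer_shift_nonzero:
  fixes x :: "'a::field_char_0"
  assumes "pochhammer x n \<noteq> 0" "k + m \<le> n"
  shows "pochhammer (x + of_nat k) m \<noteq> 0"
  using pochhammer_neq_0_mono[OF assms] by (simp add: pochhammer_product')

lemma pochhammer_reflect:
  fixes x :: "'a::comm_ring_1"
  shows "pochhammer x n = (-1) ^ n * pochhammer (1 - x - of_nat n) n"
  using pochhammer_minus[of "- x" n] by (simp add: algebra_simps)

lemma pochhammer_neg_of_nat:
  assumes "k \<le> n"
  shows "pochhammer (- of_nat n :: 'a::field_char_0) k = (-1) ^ k * fact n / fact (n - k)"
proof -
  have "fact n = (fact (n - k) * pochhammer (of_nat (n - k) + 1) k :: 'a)"
    using pochhammer_product'[of "1 :: 'a" "n - k" k] assms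
    by (simp add: pochhammer_fact add.commute)
  then show ?thesis
    using assms by (simp add: pochhammer_minus of_nat_diff)
qed

lemma saalschuetz:
  fixes a b c :: "'a::field_char_0"
  assumes "pochhammer c n \<noteq> 0" "pochhammer (c - a - b) n \<noteq> 0"
  shows "(\<Sum>k\<le>n. pochhammer (- of_nat n) k * pochhammer a k * pochhammer b k
            / (fact k * pochhammer c k * pochhammer (1 + a + b - c - of_nat n) k))
         = pochhammer (c - a) n * pochhammer (c - b) n
            / (pochhammer c n * pochhammer (c - a - b) n)"
proof -
  define d where "d = c - a - b"
  have "pochhammer (- of_nat n) k * pochhammer a k * pochhammer b k
            / (fact k * pochhammer c k * pochhammer (1 + a + b - c - of_nat n) k)
        = of_nat (n choose k) * pochhammer a k * pochhammer b k
             * pochhammer (c + of_nat k) (n - k) * pochhammer (c - a - b) (n - k)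
          / (pochhammer c n * pochhammer (c - a - b) n)"
    if "k \<le> n" for k
  proof -
    have c: "pochhammer c n = pochhammer c k * pochhammer (c + of_nat k) (n - k)"
      by (rule pochhammer_product[OF that])
    have "pochhammer d n = pochhammer d (n - k) * pochhammer (d + of_nat (n - k)) k"
      using pochhammer_product[of "n - k" n d] that by simp
    moreover have "pochhammer (1 + a + b - c - of_nat n) k = (-1) ^ k * pochhammer (d + of_nat (n - k)) k"
      using that by (subst pochhammer_reflect) (simp add: d_def of_nat_diff algebra_simps)
    \<comment> \<open>The second lower parameter runs backwards through the factors of \<open>(d)\<^sub>n\<close>; the sign from
      this reversal cancels the one in \<open>(-n)\<^sub>k\<close>.\<close>
    ultimately have d: "pochhammer d n * (-1) ^ k
        = pochhammer d (n - k) * pochhammer (1 + a + b - c - of_nat n) k"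
      by (simp add: algebra_simps flip: power_mult_distrib)
    from d assms have nz: "pochhammer d (n - k) \<noteq> 0"
        "pochhammer (1 + a + b - c - of_nat n) k \<noteq> 0"
      by (auto simp: d_def)
    have "pochhammer (- of_nat n) k * pochhammer a k * pochhammer b k
            / (fact k * pochhammer c k * pochhammer (1 + a + b - c - of_nat n) k)
        = of_nat (n choose k) * ((-1) ^ k / pochhammer (1 + a + b - c - of_nat n) k)
            * (pochhammer a k * pochhammer b k / pochhammer c k)"
      using that by (simp add: pochhammer_neg_of_nat binomial_fact mult_ac)
    also have "(-1) ^ k / pochhammer (1 + a + b - c - of_nat n) k = pochhammer d (n - k) / pochhammer d n"
      using d nz assms(2) by (simp add: divide_simps d_def mult.commute)
    also have "pochhammer a k * pochhammer b k / pochhammer c k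
        = pochhammer a k * pochhammer b k * pochhammer (c + of_nat k) (n - k) / pochhammer c n"
      using c assms(1) by simp
    finally show ?thesis
      by (simp add: d_def mult_ac)
  qed
  then have "(\<Sum>k\<le>n. pochhammer (- of_nat n) k * pochhammer a k * pochhammer b k
            / (fact k * pochhammer c k * pochhammer (1 + a + b - c - of_nat n) k))
      = (\<Sum>k\<le>n. of_nat (n choose k) * pochhammer a k * pochhammer b k
             * pochhammer (c + of_nat k) (n - k) * pochhammer (c - a - b) (n - k))
          / (pochhammer c n * pochhammer (c - a - b) n)"
    by (simp add: sum_divide_distrib)
  then show ?thesis
    by (simp add: saalschuetz_product)
qed

section \<open>Biorthogonality of rows and of columns\<close>

text \<open>
  A left inverse of a square matrix over a field is a right inverse.  Applied to the matrices
  \<open>A\<^sub>i\<^sub>j w\<^sub>j / h\<^sub>i\<close> and \<open>B\<^sub>i\<^sub>j\<close> (transposed), this exchanges the degree and the argument.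
\<close>

lemma transpose_biorthogonality:
  fixes A B :: "nat \<Rightarrow> nat \<Rightarrow> 'a::field" and w h :: "nat \<Rightarrow> 'a"
  assumes orth: "\<And>m n. m \<le> N \<Longrightarrow> n \<le> N \<Longrightarrow>
      (\<Sum>j\<le>N. w j * A m j * B n j) = (if n = m then h n else 0)"
    and h: "\<And>n. n \<le> N \<Longrightarrow> h n \<noteq> 0"
    and "m \<le> N" "n \<le> N"
  shows "(\<Sum>j\<le>N. A j m * B j n / h j) * w m = (if n = m then 1 else 0)"
proof -
  define X where "X = mat (Suc N) (Suc N) (\<lambda>(i, j). A i j * w j / h i)"
  define Y where "Y = mat (Suc N) (Suc N) (\<lambda>(j, i). B i j)"
  have X: "X \<in> carrier_mat (Suc N) (Suc N)" and Y: "Y \<in> carrier_mat (Suc N) (Suc N)"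
    by (simp_all add: X_def Y_def)
  have "X * Y = 1\<^sub>m (Suc N)"
  proof (rule eq_matI)
    fix i k assume ik: "i < dim_row (1\<^sub>m (Suc N) :: 'a mat)" "k < dim_col (1\<^sub>m (Suc N) :: 'a mat)"
    then have "(X * Y) $$ (i, k) = (\<Sum>j\<le>N. w j * A i j * B k j) / h i"
      by (simp add: X_def Y_def scalar_prod_def sum_divide_distrib mult_ac
          atLeast0LessThan lessThan_Suc_atMost del: sum.lessThan_Suc sum.op_ivl_Suc)
    then show "(X * Y) $$ (i, k) = 1\<^sub>m (Suc N) $$ (i, k)"
      using ik h[of i] by (auto simp: orth)
  qed (simp_all add: X_def Y_def)
  then have "Y * X = 1\<^sub>m (Suc N)"
    by (rule mat_mult_left_right_inverse[OF X Y])
  then have "(Y * X) $$ (n, m) = (if n = m then 1 else 0)"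
    using assms(3,4) by simp
  moreover have "(Y * X) $$ (n, m) = (\<Sum>j\<le>N. B j n * (A j m * w m / h j))"
    using assms(3,4) by (simp add: X_def Y_def scalar_prod_def
        atLeast0LessThan lessThan_Suc_atMost del: sum.lessThan_Suc sum.op_ivl_Suc)
  ultimately have "(\<Sum>j\<le>N. B j n * (A j m * w m / h j)) = (if n = m then 1 else 0)"
    by simp
  moreover have "(\<Sum>j\<le>N. A j m * B j n / h j) * w m = (\<Sum>j\<le>N. B j n * (A j m * w m / h j))"
    unfolding sum_distrib_right by (rule sum.cong) (simp_all add: mult_ac)
  ultimately show ?thesis by simp
qed

section \<open>The biorthogonal rational functions\<close>

text \<open>
  The parameters are those in which the sums are visibly balanced.  Only \<open>a\<close>, \<open>u\<close>, \<open>t\<close> and \<open>N\<close>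
  are free; \<open>v\<close>, \<open>e\<close>, \<open>f\<close> are named because they are the bases of the Pochhammer symbols.  The
  condition on \<open>t\<close> excludes \<open>t + i = 0\<close> for \<open>i \<le> 2 * N\<close>: the case \<open>i = 0\<close> is needed for
  \<open>(t+1)\<^sub>-\<^sub>1 = 1/t\<close>, the others for the denominators \<open>(t+1)\<^sub>l\<^sub>+\<^sub>k\<close> of the Hankel moments.
\<close>

locale hahn_rational =
  fixes N :: nat and a u v e f t :: "'a::field_char_0"
  assumes v: "v = t + 2 - u"
    and e: "e = of_nat N + 1 + t - u - a"
    and f: "f = a + u - of_nat N"
    and v_nonzero: "pochhammer v N \<noteq> 0"
    and f_nonzero: "pochhammer f N \<noteq> 0"
    and e_nonzero: "pochhammer e N \<noteq> 0"
    and a_nonzero: "pochhammer (- a) N \<noteq> 0"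
    and u_nonzero: "pochhammer (1 - u) N \<noteq> 0"
    and t_nonzero: "pochhammer t (2 * N + 1) \<noteq> 0"
begin

definition w :: "nat \<Rightarrow> 'a" where
  "w j = pochhammer (- of_nat N) j * pochhammer (1 - u) j * pochhammer e j
     / (fact j * pochhammer (1 - a - u) j * pochhammer v j)"

text \<open>The factor that normalises the total mass: \<open>c * w\<close> sums to one over \<open>{..N}\<close>.\<close>

definition c :: 'a where
  "c = pochhammer (1 - a - u) N * pochhammer v N / (pochhammer (- a) N * pochhammer (t + 1) N)"

definition \<phi> :: "nat \<Rightarrow> nat \<Rightarrow> 'a" where
  "\<phi> l j = pochhammer (- of_nat j) l / pochhammer (u - of_nat j) l"

definition \<psi> :: "nat \<Rightarrow> nat \<Rightarrow> 'a" where
  "\<psi> k j = pochhammer (of_nat j - of_nat N) k / pochhammer (v + of_nat j) k"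

definition U :: "nat \<Rightarrow> nat \<Rightarrow> 'a" where
  "U n j = (\<Sum>l\<le>n. pochhammer (- of_nat n) l * pochhammer (of_nat n + t) l * pochhammer (- a) l
      / (fact l * pochhammer (- of_nat N) l * pochhammer e l) * \<phi> l j)"

definition V :: "nat \<Rightarrow> nat \<Rightarrow> 'a" where
  "V m j = (\<Sum>k\<le>m. pochhammer (- of_nat m) k * pochhammer (of_nat m + t) k
        * pochhammer (a + 1 - of_nat N) k
      / (fact k * pochhammer (- of_nat N) k * pochhammer f k) * \<psi> k j)"

definition h :: "nat \<Rightarrow> 'a" where
  "h n = fact n * pochhammer (of_nat n + t) n * pochhammer (of_nat N + t + 1) n
     / (pochhammer (t + 1) (2 * n) * pochhammer (- of_nat N) n)"

lemma pochhammer_f_reflect: "pochhammer f N = (-1) ^ N * pochhammer (1 - a - u) N"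
  by (subst pochhammer_reflect) (simp add: f)

lemma au_nonzero: "pochhammer (1 - a - u) N \<noteq> 0"
  using f_nonzero by (simp add: pochhammer_f_reflect)

lemma t1_nonzero: "pochhammer (t + 1) (2 * N) \<noteq> 0"
  using pochhammer_shift_nonzero[OF t_nonzero, of 1 "2 * N"] by simp

lemma pochhammer_a_reflect: "pochhammer (a + 1 - of_nat N) N = (-1) ^ N * pochhammer (- a) N"
  by (subst pochhammer_reflect) simp

lemma a1_nonzero: "pochhammer (a + 1 - of_nat N) N \<noteq> 0"
  using a_nonzero by (simp add: pochhammer_a_reflect)

lemma c_nonzero: "c \<noteq> 0"
  using au_nonzero v_nonzero a_nonzero pochhammer_neq_0_mono[OF t1_nonzero, of N]
  by (simp add: c_def)

lemma neg_N_nonzero: "k \<le> N \<Longrightarrow> pochhammer (- of_nat N :: 'a) k \<noteq> 0"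
  by (simp add: pochhammer_of_nat_eq_0_iff)

lemma w_nonzero: "j \<le> N \<Longrightarrow> w j \<noteq> 0"
  using neg_N_nonzero[of j] pochhammer_neq_0_mono[OF au_nonzero, of j]
    pochhammer_neq_0_mono[OF v_nonzero, of j] pochhammer_neq_0_mono[OF u_nonzero, of j]
    pochhammer_neq_0_mono[OF e_nonzero, of j]
  by (simp add: w_def)

text \<open>
  For \<open>j = l + i\<close>, the denominator of \<open>\<phi>\<^sub>l(j)\<close> consists of the last \<open>l\<close> factors of
  \<open>(1-u)\<^sub>j\<close> up to sign, and its numerator is a falling factorial.  So \<open>\<phi>\<^sub>l\<close> turns
  \<open>(1-u)\<^sub>j / j!\<close> into the same expression at \<open>i\<close>.
\<close>

lemma w_phi:
  assumes "l + i \<le> N"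
  shows "pochhammer (1 - u) (l + i) / fact (l + i) * \<phi> l (l + i) = pochhammer (1 - u) i / fact i"
proof -
  have "pochhammer (- of_nat (l + i) :: 'a) l = (-1) ^ l * fact (l + i) / fact i"
    by (simp only: pochhammer_neg_of_nat[OF le_add1]) simp
  moreover have "pochhammer (u - of_nat (l + i)) l = (-1) ^ l * pochhammer (1 - u + of_nat i) l"
    by (subst pochhammer_reflect) (simp add: algebra_simps)
  moreover have "pochhammer (1 - u) (l + i) = pochhammer (1 - u) i * pochhammer (1 - u + of_nat i) l"
    using pochhammer_product'[of "1 - u" i l] by (simp add: add.commute)
  moreover have "pochhammer (1 - u) (l + i) \<noteq> 0"
    using pochhammer_neq_0_mono[OF u_nonzero] assms by simp
  ultimately show ?thesis
    by (simp add: \<phi>_def)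
qed

text \<open>
  The summand of the moment as a term of a \<open>\<^sub>3F\<^sub>2\<close> in \<open>i = j - l\<close>.  The factor \<open>\<psi>\<^sub>k\<close> extends
  \<open>(-N)\<^sub>j / (v)\<^sub>j\<close> to index \<open>j + k\<close>.
\<close>

lemma moment_term:
  assumes "l + k + i \<le> N"
  shows "w (l + i) * \<phi> l (l + i) * \<psi> k (l + i)
    = pochhammer (- of_nat N) (l + k) * pochhammer e l
        / (pochhammer v (l + k) * pochhammer (1 - a - u) l)
      * (pochhammer (- of_nat (N - l - k)) i * pochhammer (1 - u) i * pochhammer (e + of_nat l) i
        / (fact i * pochhammer (v + of_nat (l + k)) i * pochhammer (1 - a - u + of_nat l) i))"
proof -
  have swap: "pochhammer x (l + i) * pochhammer (x + of_nat (l + i)) k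
      = pochhammer x (l + k) * pochhammer (x + of_nat (l + k)) i" for x :: 'a
    unfolding pochhammer_product'[symmetric] by (simp add: add_ac)
  have psi: "pochhammer (- of_nat N) (l + i) / pochhammer v (l + i) * \<psi> k (l + i)
      = pochhammer (- of_nat N) (l + k) * pochhammer (- of_nat (N - l - k)) i
        / (pochhammer v (l + k) * pochhammer (v + of_nat (l + k)) i)"
    using swap[of "- of_nat N"] swap[of v] assms
    by (simp add: \<psi>_def of_nat_diff algebra_simps)
  have "w (l + i) * \<phi> l (l + i) * \<psi> k (l + i)
      = (pochhammer (1 - u) (l + i) / fact (l + i) * \<phi> l (l + i))
        * (pochhammer (- of_nat N) (l + i) / pochhammer v (l + i) * \<psi> k (l + i))
        * (pochhammer e (l + i) / pochhammer (1 - a - u) (l + i))"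
    by (simp add: w_def mult_ac)
  also have "\<dots> = (pochhammer (1 - u) i / fact i)
        * (pochhammer (- of_nat N) (l + k) * pochhammer (- of_nat (N - l - k)) i
        / (pochhammer v (l + k) * pochhammer (v + of_nat (l + k)) i))
        * (pochhammer e l * pochhammer (e + of_nat l) i
        / (pochhammer (1 - a - u) l * pochhammer (1 - a - u + of_nat l) i))"
    using assms by (subst w_phi; (subst psi)?) (simp_all add: pochhammer_product')
  finally show ?thesis
    by (simp add: mult_ac)
qed

lemma phi_zero: "j < l \<Longrightarrow> \<phi> l j = 0"
  by (simp add: \<phi>_def pochhammer_of_nat_eq_0_iff)

lemma psi_zero: "j \<le> N \<Longrightarrow> N < j + k \<Longrightarrow> \<psi> k j = 0"
  using pochhammer_of_nat_eq_0_lemma[of "N - j" k, where 'a='a]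
  by (simp add: \<psi>_def of_nat_diff)

text \<open>
  The moments in closed form, by the first use of the summation theorem.  The numerator
  \<open>(e)\<^sub>l (f)\<^sub>k\<close> and the denominator \<open>(-a)\<^sub>l (a+1-N)\<^sub>k\<close> are what \<open>U\<close> and \<open>V\<close> are built to cancel.
\<close>

lemma moment:
  assumes "l \<le> N" "k \<le> N"
  shows "c * (\<Sum>j\<le>N. w j * \<phi> l j * \<psi> k j)
    = pochhammer (- of_nat N) (l + k) * pochhammer e l * pochhammer f k
      / (pochhammer (t + 1) (l + k) * pochhammer (- a) l * pochhammer (a + 1 - of_nat N) k)"
proof (cases "l + k \<le> N")
  case False
  then have "w j * \<phi> l j * \<psi> k j = 0" if "j \<le> N" for j
    using that phi_zero[of j l] psi_zero[of j k] by (cases "j < l") auto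
  moreover have "pochhammer (- of_nat N :: 'a) (l + k) = 0"
    using False by (simp add: pochhammer_of_nat_eq_0_iff)
  ultimately show ?thesis by (simp del: mult_eq_0_iff)
next
  case True
  define n where "n = N - l - k"
  have N: "N = l + k + n" using True by (simp add: n_def)
  have sum: "(\<Sum>j\<le>N. w j * \<phi> l j * \<psi> k j) = (\<Sum>i\<le>n. w (l + i) * \<phi> l (l + i) * \<psi> k (l + i))"
  proof -
    have "(\<Sum>j\<le>N. w j * \<phi> l j * \<psi> k j) = (\<Sum>j\<in>(+) l ` {..n}. w j * \<phi> l j * \<psi> k j)"
    proof (rule sum.mono_neutral_right)
      show "\<forall>j\<in>{..N} - (+) l ` {..n}. w j * \<phi> l j * \<psi> k j = 0"
      proof
        fix j assume j: "j \<in> {..N} - (+) l ` {..n}"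
        have "j < l \<or> N < j + k"
        proof (rule ccontr)
          assume "\<not> ?thesis"
          then have "j = l + (j - l)" "j - l \<le> n" by (auto simp: N)
          with j show False by blast
        qed
        with j show "w j * \<phi> l j * \<psi> k j = 0"
          using phi_zero[of j l] psi_zero[of j k] by auto
      qed
    qed (auto simp: N)
    then show ?thesis
      by (simp add: sum.reindex)
  qed
  have v_l: "pochhammer v N = pochhammer v (l + k) * pochhammer (v + of_nat (l + k)) n"
    unfolding N by (rule pochhammer_product')
  have t_l: "pochhammer (t + 1) N = pochhammer (t + 1) (l + k) * pochhammer (t + 1 + of_nat (l + k)) n"
    unfolding N by (rule pochhammer_product')
  \<comment> \<open>The reflection \<open>x = 1 - y - N\<close> reverses the \<open>N\<close> factors of \<open>(y)\<^sub>N\<close>, so the last \<open>l\<close> factors of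
    \<open>(x)\<^sub>N\<close> are the first \<open>l\<close> of \<open>(y)\<^sub>N\<close>.  It is needed for the pairs \<open>f\<close>, \<open>1-a-u\<close> and
    \<open>a+1-N\<close>, \<open>-a\<close>; the signs agree and cancel in the quotient.\<close>
  have split: "(-1) ^ N * pochhammer y N
      = (-1) ^ l * pochhammer x k * pochhammer (x + of_nat k) n * pochhammer y l"
    if x: "x = 1 - y - of_nat N" for x y :: 'a
  proof -
    have "(-1) ^ N * pochhammer y N = pochhammer x (k + n + l)"
      using pochhammer_reflect[of x N] N by (simp add: x add_ac)
    also have "\<dots> = pochhammer x k * pochhammer (x + of_nat k) n * pochhammer (1 - y - of_nat l) l"
    proof -
      have "x + of_nat (k + n) = 1 - y - of_nat l"
        by (simp add: x N)
      then show ?thesis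
        by (simp only: pochhammer_product'[of x "k + n" l] pochhammer_product'[of x k n])
    qed
    also have "pochhammer (1 - y - of_nat l) l = (-1) ^ l * pochhammer y l"
      by (subst pochhammer_reflect) simp
    finally show ?thesis by (simp add: mult_ac)
  qed
  have f_l: "(-1) ^ N * pochhammer (1 - a - u) N
      = (-1) ^ l * pochhammer f k * pochhammer (f + of_nat k) n * pochhammer (1 - a - u) l"
    by (rule split) (simp add: f)
  have a_l: "(-1) ^ N * pochhammer (- a) N
      = (-1) ^ l * pochhammer (a + 1 - of_nat N) k * pochhammer (a + 1 - of_nat N + of_nat k) n
        * pochhammer (- a) l"
    by (rule split) simp
  have balance: "t + 1 + of_nat (l + k) - (e + of_nat l) = f + of_nat k"
      "1 + (1 - u) + (e + of_nat l) - (v + of_nat (l + k)) - of_nat n = 1 - a - u + of_nat l"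
      "v + of_nat (l + k) - (1 - u) = t + 1 + of_nat (l + k)"
      "v + of_nat (l + k) - (e + of_nat l) = a + 1 - of_nat N + of_nat k"
    by (simp_all add: v e f N)
  have "(\<Sum>j\<le>N. w j * \<phi> l j * \<psi> k j)
      = pochhammer (- of_nat N) (l + k) * pochhammer e l
        / (pochhammer v (l + k) * pochhammer (1 - a - u) l)
      * (\<Sum>i\<le>n. pochhammer (- of_nat n) i * pochhammer (1 - u) i * pochhammer (e + of_nat l) i
        / (fact i * pochhammer (v + of_nat (l + k)) i * pochhammer (1 - a - u + of_nat l) i))"
    unfolding sum sum_distrib_left
    by (intro sum.cong refl, subst moment_term) (simp_all add: N)
  also have "(\<Sum>i\<le>n. pochhammer (- of_nat n) i * pochhammer (1 - u) i * pochhammer (e + of_nat l) i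
        / (fact i * pochhammer (v + of_nat (l + k)) i * pochhammer (1 - a - u + of_nat l) i))
      = pochhammer (t + 1 + of_nat (l + k)) n * pochhammer (a + 1 - of_nat N + of_nat k) n
        / (pochhammer (v + of_nat (l + k)) n * pochhammer (f + of_nat k) n)"
    using saalschuetz[of "v + of_nat (l + k)" n "1 - u" "e + of_nat l", unfolded balance]
      pochhammer_shift_nonzero[OF v_nonzero, of "l + k" n]
      pochhammer_shift_nonzero[OF f_nonzero, of k n] by (simp add: N)
  finally have moment: "(\<Sum>j\<le>N. w j * \<phi> l j * \<psi> k j)
      = pochhammer (- of_nat N) (l + k) * pochhammer e l
        / (pochhammer v (l + k) * pochhammer (1 - a - u) l)
      * (pochhammer (t + 1 + of_nat (l + k)) n * pochhammer (a + 1 - of_nat N + of_nat k) n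
        / (pochhammer (v + of_nat (l + k)) n * pochhammer (f + of_nat k) n))" .
  have "c = ((-1) ^ N * pochhammer (1 - a - u) N) * pochhammer v N
      / (((-1) ^ N * pochhammer (- a) N) * pochhammer (t + 1) N)"
    by (simp add: c_def)
  also have "\<dots> = (pochhammer f k * pochhammer (f + of_nat k) n * pochhammer (1 - a - u) l)
        * (pochhammer v (l + k) * pochhammer (v + of_nat (l + k)) n)
      / ((pochhammer (a + 1 - of_nat N) k * pochhammer (a + 1 - of_nat N + of_nat k) n
          * pochhammer (- a) l)
        * (pochhammer (t + 1) (l + k) * pochhammer (t + 1 + of_nat (l + k)) n))"
    unfolding f_l a_l v_l t_l by (simp add: mult_ac)
  finally have c: "c = \<dots>" .
  have nz: "pochhammer (f + of_nat k) n \<noteq> 0" "pochhammer (1 - a - u) l \<noteq> 0"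
      "pochhammer v (l + k) \<noteq> 0" "pochhammer (v + of_nat (l + k)) n \<noteq> 0"
      "pochhammer (a + 1 - of_nat N + of_nat k) n \<noteq> 0"
      "pochhammer (t + 1 + of_nat (l + k)) n \<noteq> 0"
    using f_l a_l t_l v_l au_nonzero a_nonzero v_nonzero pochhammer_neq_0_mono[OF t1_nonzero, of N]
    by auto
  show ?thesis
    unfolding moment c using nz by (simp add: divide_simps)
qed

section \<open>The residual bilinear form\<close>

text \<open>
  The part of the coefficients of \<open>U\<close> and \<open>V\<close> that is common to both and involves only \<open>t\<close> and \<open>N\<close>.
\<close>

definition r :: "nat \<Rightarrow> nat \<Rightarrow> 'a" where
  "r n l = pochhammer (- of_nat n) l * pochhammer (of_nat n + t) l
     / (fact l * pochhammer (- of_nat N) l)"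

definition S :: "nat \<Rightarrow> nat \<Rightarrow> 'a" where
  "S n m = (\<Sum>l\<le>n. \<Sum>k\<le>m. r n l * r m k
      * (pochhammer (- of_nat N) (l + k) / pochhammer (t + 1) (l + k)))"

lemma S_commute: "S n m = S m n"
  unfolding S_def by (subst sum.swap) (simp add: mult_ac add.commute)

text \<open>The second balanced sum; the factor \<open>(l+1-m)\<^sub>m\<close> is what makes \<open>S\<close> triangular.\<close>

lemma S_inner:
  assumes "l \<le> N" "m \<le> N"
  shows "(\<Sum>k\<le>m. r m k
        * (pochhammer (- of_nat N) (l + k) / pochhammer (t + 1) (l + k)))
    = pochhammer (- of_nat N) l / pochhammer (t + 1) l
      * (pochhammer (of_nat l + 1 - of_nat m) m * pochhammer (t + 1 + of_nat N) m
        / (pochhammer (t + 1 + of_nat l) m * pochhammer (of_nat N + 1 - of_nat m) m))"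
proof -
  have balance: "of_nat l + 1 - of_nat m - (of_nat l - of_nat N) = (of_nat N + 1 - of_nat m :: 'a)"
      "1 + (of_nat m + t) + (of_nat l - of_nat N) - (t + 1 + of_nat l) - of_nat m = - of_nat N"
      "t + 1 + of_nat l - (of_nat m + t) = of_nat l + 1 - of_nat m"
      "t + 1 + of_nat l - (of_nat l - of_nat N) = t + 1 + of_nat N"
    by simp_all
  have nz: "pochhammer (t + 1 + of_nat l) m \<noteq> 0"
    using pochhammer_shift_nonzero[OF t1_nonzero, of l m] assms by simp
  have "pochhammer (of_nat N + 1 - of_nat m :: 'a) m = (-1) ^ m * pochhammer (- of_nat N) m"
    by (subst pochhammer_reflect) simp
  with neg_N_nonzero[OF assms(2)] have nz': "pochhammer (of_nat N + 1 - of_nat m :: 'a) m \<noteq> 0"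
    by simp
  have "(\<Sum>k\<le>m. r m k
        * (pochhammer (- of_nat N) (l + k) / pochhammer (t + 1) (l + k)))
      = pochhammer (- of_nat N) l / pochhammer (t + 1) l
       * (\<Sum>k\<le>m. pochhammer (- of_nat m) k * pochhammer (of_nat m + t) k
          * pochhammer (of_nat l - of_nat N) k
          / (fact k * pochhammer (t + 1 + of_nat l) k * pochhammer (- of_nat N) k))"
    unfolding sum_distrib_left
    by (intro sum.cong refl) (simp add: pochhammer_product' r_def mult_ac)
  also note saalschuetz[of "t + 1 + of_nat l" m "of_nat m + t" "of_nat l - of_nat N",
      unfolded balance, OF nz nz']
  finally show ?thesis .
qed

lemma S_single_sum:
  assumes "n \<le> N" "m \<le> N"
  shows "S n m = (\<Sum>l\<le>n. r n l * (pochhammer (- of_nat N) l / pochhammer (t + 1) l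
      * (pochhammer (of_nat l + 1 - of_nat m) m * pochhammer (t + 1 + of_nat N) m
        / (pochhammer (t + 1 + of_nat l) m * pochhammer (of_nat N + 1 - of_nat m) m))))"
  unfolding S_def mult.assoc sum_distrib_left[symmetric]
  using assms by (intro sum.cong refl) (simp only: S_inner atMost_iff le_trans)

lemma pochhammer_vanish:
  assumes "l < m"
  shows "pochhammer (of_nat l + 1 - of_nat m :: 'a) m = 0"
  using pochhammer_of_nat_eq_0_lemma[of "m - 1 - l" m, where 'a='a] assms
  by (simp add: of_nat_diff add_ac)

lemma S_eq_0:
  assumes "n < m" "m \<le> N"
  shows "S n m = 0"
  using assms by (simp add: S_single_sum pochhammer_vanish)

text \<open>On the diagonal only \<open>l = n\<close> survives, since the summands with \<open>l < n\<close> vanish.\<close>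

lemma S_diag:
  assumes "n \<le> N"
  shows "S n n = h n"
proof -
  have N_n: "pochhammer (of_nat N + 1 - of_nat n :: 'a) n = (-1) ^ n * pochhammer (- of_nat N) n"
    by (subst pochhammer_reflect) simp
  have n_n: "pochhammer (- of_nat n :: 'a) n = (-1) ^ n * fact n"
    by (simp add: pochhammer_same)
  have "S n n = r n n * (pochhammer (- of_nat N) n / pochhammer (t + 1) n
      * (pochhammer (of_nat n + 1 - of_nat n) n * pochhammer (t + 1 + of_nat N) n
        / (pochhammer (t + 1 + of_nat n) n * pochhammer (of_nat N + 1 - of_nat n) n)))"
    unfolding S_single_sum[OF assms assms]
    by (rule sum.remove[of _ n, THEN trans]) (auto simp: pochhammer_vanish intro!: sum.neutral)
  also have "\<dots> = h n"
    using neg_N_nonzero[OF assms] unfolding N_n r_def n_n h_def mult_2 pochhammer_product'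
    by (simp add: pochhammer_fact[symmetric] ac_simps)
  finally show ?thesis .
qed

lemma h_nonzero:
  assumes "n \<le> N"
  shows "h n \<noteq> 0"
proof -
  have "pochhammer (t + of_nat n) n \<noteq> 0" "pochhammer (t + (1 + of_nat N)) n \<noteq> 0"
      "pochhammer (t + 1) (2 * n) \<noteq> 0"
    using pochhammer_shift_nonzero[OF t_nonzero, of n n]
      pochhammer_shift_nonzero[OF t_nonzero, of "N + 1" n] pochhammer_neq_0_mono[OF t1_nonzero] assms
    by (simp_all add: ac_simps)
  then show ?thesis
    using neg_N_nonzero[OF assms] by (simp add: h_def add_ac)
qed

lemma U_eq: "U n j = (\<Sum>l\<le>n. r n l * (pochhammer (- a) l / pochhammer e l) * \<phi> l j)"
  unfolding U_def r_def by (intro sum.cong refl) (simp add: mult_ac)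

lemma V_eq: "V m j = (\<Sum>k\<le>m. r m k * (pochhammer (a + 1 - of_nat N) k / pochhammer f k) * \<psi> k j)"
  unfolding V_def r_def by (intro sum.cong refl) (simp add: mult_ac)

lemma biorthogonality:
  assumes "n \<le> N" "m \<le> N"
  shows "(\<Sum>j\<le>N. c * w j * V m j * U n j) = (if n = m then h n else 0)"
proof -
  define g where "g l = pochhammer (- a) l / pochhammer e l" for l
  define g' where "g' k = pochhammer (a + 1 - of_nat N) k / pochhammer f k" for k
  have "(\<Sum>j\<le>N. c * w j * V m j * U n j)
      = (\<Sum>j\<le>N. \<Sum>l\<le>n. \<Sum>k\<le>m. r n l * r m k * g l * g' k * (c * (w j * \<phi> l j * \<psi> k j)))"
    unfolding U_eq V_eq g_def g'_def sum_distrib_left sum_distrib_right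
    by (intro sum.cong refl) (simp add: mult_ac)
  also have "\<dots> = (\<Sum>l\<le>n. \<Sum>k\<le>m. r n l * r m k * g l * g' k
      * (c * (\<Sum>j\<le>N. w j * \<phi> l j * \<psi> k j)))"
    unfolding sum_distrib_left sum.swap[of _ "{..N}"] ..
  also have "\<dots> = S n m"
    unfolding S_def
  proof (intro sum.cong refl)
    fix l k assume lk: "l \<in> {..n}" "k \<in> {..m}"
    then have le: "l \<le> N" "k \<le> N" using assms by auto
    then have "pochhammer (- a) l \<noteq> 0" "pochhammer e l \<noteq> 0"
        "pochhammer (a + 1 - of_nat N) k \<noteq> 0" "pochhammer f k \<noteq> 0"
      using pochhammer_neq_0_mono[OF a_nonzero] pochhammer_neq_0_mono[OF e_nonzero]
        pochhammer_neq_0_mono[OF a1_nonzero] pochhammer_neq_0_mono[OF f_nonzero] by auto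
    then show "r n l * r m k * g l * g' k * (c * (\<Sum>j\<le>N. w j * \<phi> l j * \<psi> k j))
        = r n l * r m k * (pochhammer (- of_nat N) (l + k) / pochhammer (t + 1) (l + k))"
      unfolding moment[OF le] g_def g'_def by simp
  qed
  also have "\<dots> = (if n = m then h n else 0)"
    using assms S_eq_0[of n m] S_eq_0[of m n] S_diag[of n] S_commute[of n m]
    by (cases n m rule: linorder_cases) auto
  finally show ?thesis .
qed

lemma dual_biorthogonality:
  assumes "n \<le> N" "m \<le> N"
  shows "(\<Sum>j\<le>N. c / h j * V j m * U j n) = (if n = m then 1 / w n else 0)"
proof -
  have "(\<Sum>j\<le>N. V j m * U j n / h j) * (c * w m) = (if n = m then 1 else 0)"
    by (rule transpose_biorthogonality[where w = "\<lambda>j. c * w j"])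
      (use assms biorthogonality h_nonzero in auto)
  moreover have "(\<Sum>j\<le>N. c / h j * V j m * U j n) = c * (\<Sum>j\<le>N. V j m * U j n / h j)"
    by (simp add: sum_distrib_left mult_ac)
  ultimately show ?thesis
    using w_nonzero[OF assms(2)] c_nonzero by (auto simp: field_simps)
qed

end

section \<open>Translation to the parameters \<open>\<alpha>\<close>, \<open>\<beta>\<close>, \<open>\<zeta>\<close>\<close>

text \<open>
  The conditions on \<open>v\<close> and \<open>f\<close> come from the denominators of the partner functions at
  \<open>n = l = N\<close>, and the condition on \<open>t\<close> from the denominators \<open>(j+t)\<^sub>N\<^sub>+\<^sub>1\<close> of \<open>W\<^sup>*\<close> at \<open>j = 0\<close>
  and \<open>j = N\<close>, which together cover \<open>t, \<dots>, t + 2N\<close>.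
\<close>

lemma hahn_rational_of_generic:
  assumes "generic \<alpha> \<beta> \<zeta> N"
  shows "hahn_rational N \<alpha> (\<alpha> - \<beta>) (1 - \<alpha> - \<beta> - 2 * \<zeta>) (real N - 2 * \<alpha> - \<beta> - 2 * \<zeta>)
    (2 * \<alpha> - \<beta> - real N) (- 2 * \<beta> - 2 * \<zeta> - 1)"
proof
  let ?t = "- 2 * \<beta> - 2 * \<zeta> - 1"
  have U: "U_denoms_nonzero (real N - \<alpha> - 1) (\<beta> + 2 * \<zeta> - 2) (2 - \<zeta>) N"
    using assms unfolding generic_def by blast
  have "pochs (Ulower N (real N - \<alpha> - 1) (\<beta> + 2 * \<zeta> - 2) (2 - \<zeta>) N) N \<noteq> 0"
    using U[unfolded U_denoms_nonzero_def, rule_format, of N N N] by simp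
  then show "pochhammer (1 - \<alpha> - \<beta> - 2 * \<zeta>) N \<noteq> 0" "pochhammer (2 * \<alpha> - \<beta> - real N) N \<noteq> 0"
    by (simp_all add: pochs_def Ulower_def algebra_simps)
  have "pochs [- real N, 1 - \<alpha> + \<beta>, real N - 2 * \<alpha> - \<beta> - 2 * \<zeta>] N \<noteq> 0"
    using assms by (simp add: generic_def)
  then show "pochhammer (real N - 2 * \<alpha> - \<beta> - 2 * \<zeta>) N \<noteq> 0" "pochhammer (1 - (\<alpha> - \<beta>)) N \<noteq> 0"
    by (simp_all add: pochs_def algebra_simps)
  show "pochhammer (- \<alpha>) N \<noteq> 0"
    using assms by (simp add: generic_def)
  have "pochhammer (real j - 1 - 2 * \<beta> - 2 * \<zeta>) (N + 1) \<noteq> 0" if "j \<le> N" for j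
    using assms that unfolding generic_def by blast
  from this[of 0] this[of N] have "pochhammer (real 0 - 1 - 2 * \<beta> - 2 * \<zeta>) (N + 1) \<noteq> 0"
      "pochhammer (real N - 1 - 2 * \<beta> - 2 * \<zeta>) (N + 1) \<noteq> 0"
    by blast+
  moreover have "real 0 - 1 - 2 * \<beta> - 2 * \<zeta> = ?t" "real N - 1 - 2 * \<beta> - 2 * \<zeta> = ?t + real N"
    by simp_all
  ultimately have "pochhammer ?t (N + 1) \<noteq> 0" "pochhammer (?t + real N) (N + 1) \<noteq> 0"
    by (simp_all only: not_False_eq_True)
  moreover have "pochhammer ?t (2 * N + 1) = pochhammer ?t N * pochhammer (?t + real N) (N + 1)"
  proof -
    have "2 * N + 1 = N + (N + 1)"
      by simp
    then show ?thesis
      by (simp only: pochhammer_product')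
  qed
  moreover have "pochhammer ?t N \<noteq> 0"
    using calculation(1) by (rule pochhammer_neq_0_mono) simp
  ultimately show "pochhammer ?t (2 * N + 1) \<noteq> 0"
    by (simp only: mult_eq_0_iff simp_thms)
qed simp_all

text \<open>
  The convention \<open>(x+1)\<^sub>-\<^sub>1 = 1/x\<close> is the one under which \<open>(x+1)\<^sub>n\<^sub>-\<^sub>1\<close> continues into \<open>(x+n)\<^sub>k\<^sub>+\<^sub>1\<close>
  also for \<open>n = 0\<close>.
\<close>

lemma rising_pred:
  fixes x :: real
  assumes "x \<noteq> 0"
  shows "rising (x + 1) (int n - 1) * pochhammer (x + real n) (k + 1) = pochhammer (x + 1) (n + k)"
proof (cases n)
  case 0
  then show ?thesis
    using assms by (simp add: rising_def pochhammer_rec)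
next
  case (Suc i)
  have "pochhammer (x + 1) (n + k) = pochhammer (x + 1) (i + (k + 1))"
    by (simp add: Suc)
  also have "\<dots> = pochhammer (x + 1) i * pochhammer (x + 1 + real i) (k + 1)"
    by (rule pochhammer_product')
  finally show ?thesis
    by (simp add: rising_def Suc add_ac)
qed

lemma rising_double:
  fixes x :: real
  assumes "x \<noteq> 0"
  shows "(2 * real n + x) * rising (x + 1) (int n - 1) * pochhammer (real n + x) n
    = pochhammer (x + 1) (2 * n)"
  using rising_pred[OF assms, of n n] unfolding mult_2 by (simp add: pochhammer_Suc ac_simps)

context
  fixes \<alpha> \<beta> \<zeta> :: real and N :: nat
  assumes generic: "generic \<alpha> \<beta> \<zeta> N"
begin

interpretation hahn_rational N \<alpha> "\<alpha> - \<beta>" "1 - \<alpha> - \<beta> - 2 * \<zeta>" "real N - 2 * \<alpha> - \<beta> - 2 * \<zeta>"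
    "2 * \<alpha> - \<beta> - real N" "- 2 * \<beta> - 2 * \<zeta> - 1"
  by (rule hahn_rational_of_generic[OF generic])

text \<open>
  Cutting the series off at \<open>min n j\<close> instead of \<open>n\<close> changes nothing, as \<open>\<phi>\<^sub>l(j) = 0\<close> for \<open>l > j\<close>.
\<close>

lemma Ufun_eq_U: "Ufun n j \<alpha> \<beta> \<zeta> N = U n j"
proof -
  have "Ufun n j \<alpha> \<beta> \<zeta> N
      = (\<Sum>l\<le>min n j. pochhammer (- real n) l * pochhammer (real n + (- 2 * \<beta> - 2 * \<zeta> - 1)) l
          * pochhammer (- \<alpha>) l
      / (fact l * pochhammer (- real N) l * pochhammer (real N - 2 * \<alpha> - \<beta> - 2 * \<zeta>) l) * \<phi> l j)"
    unfolding Ufun_def \<phi>_def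
    by (intro sum.cong refl) (simp add: pochs_def Ulower_def algebra_simps)
  also have "\<dots> = U n j"
    unfolding U_def by (intro sum.mono_neutral_left) (auto simp: phi_zero)
  finally show ?thesis .
qed

lemma Utilde_eq_V:
  assumes "j \<le> N"
  shows "Utilde m j \<alpha> \<beta> \<zeta> N = V m j"
proof -
  have "Utilde m j \<alpha> \<beta> \<zeta> N
      = (\<Sum>k\<le>min m (N - j). pochhammer (- real m) k * pochhammer (real m + (- 2 * \<beta> - 2 * \<zeta> - 1)) k
        * pochhammer (\<alpha> + 1 - real N) k
      / (fact k * pochhammer (- real N) k * pochhammer (2 * \<alpha> - \<beta> - real N) k) * \<psi> k j)"
    unfolding Utilde_def Ufun_def \<psi>_def using assms
    by (intro sum.cong refl) (simp add: pochs_def Ulower_def of_nat_diff algebra_simps)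
  also have "\<dots> = V m j"
    unfolding V_def using assms by (intro sum.mono_neutral_left) (auto simp: psi_zero)
  finally show ?thesis .
qed

text \<open>
  The two Pochhammer symbols of length \<open>N - j\<close> are reflections of the tails of \<open>(1-a-u)\<^sub>N\<close> and
  \<open>(v)\<^sub>N\<close>; both carry the sign \<open>(-1)\<^bsup>N-j\<^esup>\<close>.
\<close>

lemma weight_W_eq:
  assumes "j \<le> N"
  shows "weight_W \<alpha> \<beta> \<zeta> N j = c * w j"
proof -
  have f: "pochhammer (2 * \<alpha> - \<beta> - real N) (N - j)
      = (-1) ^ (N - j) * pochhammer (1 - \<alpha> - (\<alpha> - \<beta>) + real j) (N - j)"
    using assms by (subst pochhammer_reflect) (simp add: of_nat_diff algebra_simps)
  have v: "pochhammer (\<alpha> + \<beta> - real N + 2 * \<zeta>) (N - j)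
      = (-1) ^ (N - j) * pochhammer (1 - \<alpha> - \<beta> - 2 * \<zeta> + real j) (N - j)"
    using assms by (subst pochhammer_reflect) (simp add: of_nat_diff algebra_simps)
  have nz: "pochhammer (1 - \<alpha> - (\<alpha> - \<beta>)) j \<noteq> 0" "pochhammer (1 - \<alpha> - \<beta> - 2 * \<zeta>) j \<noteq> 0"
    using pochhammer_neq_0_mono[OF au_nonzero assms] pochhammer_neq_0_mono[OF v_nonzero assms]
    by simp_all
  have sign: "(-1) ^ (N - j) * (-1) ^ (N - j) = (1 :: real)"
    by (simp flip: power_mult_distrib)
  have u: "1 - \<alpha> + \<beta> = 1 - (\<alpha> - \<beta>)" "- 2 * \<beta> - 2 * \<zeta> = - 2 * \<beta> - 2 * \<zeta> - 1 + 1" by simp_all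
  have "weight_W \<alpha> \<beta> \<zeta> N j = ((-1) ^ (N - j) * (-1) ^ (N - j)) * (c * w j)"
    unfolding weight_W_def pochs_def c_def w_def pochhammer_product[OF assms, of "1 - \<alpha> - (\<alpha> - \<beta>)"]
      pochhammer_product[OF assms, of "1 - \<alpha> - \<beta> - 2 * \<zeta>"] list.map prod_list.Cons prod_list.Nil f v u(1)
    using nz by (subst u(2)) (simp add: mult_ac)
  then show ?thesis by (simp only: sign mult_1)
qed

lemma norm_h_star_eq: "norm_h_star \<alpha> \<beta> \<zeta> N n = 1 / w n"
proof -
  have u: "1 - 2 * \<alpha> + \<beta> = 1 - \<alpha> - (\<alpha> - \<beta>)" "1 - \<alpha> + \<beta> = 1 - (\<alpha> - \<beta>)"
    by simp_all
  show ?thesis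
    unfolding norm_h_star_def w_def pochs_def u pochhammer_fact by (simp add: mult_ac)
qed

lemma norm_h_eq:
  assumes "n \<le> N"
  shows "norm_h \<alpha> \<beta> \<zeta> N n = h n"
proof -
  define t where "t = - 2 * \<beta> - 2 * \<zeta> - 1"
  have t: "real N - 2 * \<beta> - 2 * \<zeta> = real N + t + 1" "2 * real n - 1 - 2 * \<beta> - 2 * \<zeta> = 2 * real n + t"
      "- 2 * \<beta> - 2 * \<zeta> = t + 1"
    by (simp_all add: t_def)
  have nz: "t \<noteq> 0" "pochhammer (real n + t) n \<noteq> 0"
    using pochhammer_neq_0_mono[OF t_nonzero, of 1] pochhammer_shift_nonzero[OF t_nonzero, of n n]
      assms by (simp_all add: t_def add.commute)
  show ?thesis
    unfolding norm_h_def h_def unfolding t_def[symmetric] unfolding t rising_double[OF nz(1), symmetric]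
    using nz(2) by (simp add: mult_ac)
qed

text \<open>
  The dual weight is the reciprocal norm: \<open>W\<^sup>*(j) h\<^sub>j\<close> does not depend on \<open>j\<close>, because
  \<open>(t+1)\<^sub>j\<^sub>-\<^sub>1 (t+j)\<^sub>N\<^sub>+\<^sub>1\<close> and \<open>(t+1)\<^sub>N (t+N+1)\<^sub>j\<close> are both \<open>(t+1)\<^sub>N\<^sub>+\<^sub>j\<close>.
\<close>

lemma weight_W_star_eq:
  assumes "j \<le> N"
  shows "weight_W_star \<alpha> \<beta> \<zeta> N j = c / h j"
proof -
  define t where "t = - 2 * \<beta> - 2 * \<zeta> - 1"
  have t: "real j - 1 - 2 * \<beta> - 2 * \<zeta> = t + real j" "2 * real j - 1 - 2 * \<beta> - 2 * \<zeta> = 2 * real j + t"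
      "1 - 2 * \<alpha> + \<beta> = 1 - \<alpha> - (\<alpha> - \<beta>)"
    by (simp_all add: t_def)
  have t0: "t \<noteq> 0"
    using pochhammer_neq_0_mono[OF t_nonzero, of 1] by (simp add: t_def)
  have nz: "pochhammer (real j + t) j \<noteq> 0" "pochhammer (t + 1) (j + N) \<noteq> 0"
    using pochhammer_shift_nonzero[OF t_nonzero, of j j]
      pochhammer_neq_0_mono[OF t1_nonzero, of "j + N"] assms
    by (simp_all add: t_def add.commute)
  have "real N + t + 1 = t + 1 + real N"
    by simp
  then have split: "pochhammer (t + 1) N * pochhammer (real N + t + 1) j
      = rising (t + 1) (int j - 1) * pochhammer (t + real j) (N + 1)"
    using pochhammer_product'[of "t + 1" N j] rising_pred[OF t0, of j N]
    by (simp only: add.commute[of j N])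
  have nz': "rising (t + 1) (int j - 1) \<noteq> 0"
    using rising_pred[OF t0, of j N] nz(2) by auto
  have "c / h j = pochhammer (- real N) j / fact j
      * (pochhammer (t + 1) (2 * j) / (pochhammer (real j + t) j
          * (pochhammer (t + 1) N * pochhammer (real N + t + 1) j)))
      * (pochhammer (1 - \<alpha> - (\<alpha> - \<beta>)) N * pochhammer (1 - \<alpha> - \<beta> - 2 * \<zeta>) N
          / pochhammer (- \<alpha>) N)"
    unfolding c_def h_def unfolding t_def[symmetric] by (simp add: mult_ac)
  also have "pochhammer (t + 1) (2 * j) / (pochhammer (real j + t) j
          * (pochhammer (t + 1) N * pochhammer (real N + t + 1) j))
      = (2 * real j + t) / pochhammer (t + real j) (N + 1)"
    unfolding split rising_double[OF t0, symmetric] using nz(1) nz' by (simp add: mult_ac)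
  finally show ?thesis
    unfolding weight_W_star_def t by (simp add: pochs_def)
qed

lemma weight_W_biorthogonality:
  assumes "m \<le> N" "n \<le> N"
  shows "(\<Sum>j=0..N. weight_W \<alpha> \<beta> \<zeta> N j * Utilde m j \<alpha> \<beta> \<zeta> N * Ufun n j \<alpha> \<beta> \<zeta> N)
    = norm_h \<alpha> \<beta> \<zeta> N n * (if n = m then 1 else 0)"
proof -
  have "(\<Sum>j=0..N. weight_W \<alpha> \<beta> \<zeta> N j * Utilde m j \<alpha> \<beta> \<zeta> N * Ufun n j \<alpha> \<beta> \<zeta> N)
      = (\<Sum>j\<le>N. c * w j * V m j * U n j)"
    unfolding atLeast0AtMost
    by (intro sum.cong refl) (simp only: weight_W_eq Utilde_eq_V Ufun_eq_U atMost_iff)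
  then show ?thesis
    unfolding biorthogonality[OF assms(2,1)] norm_h_eq[OF assms(2)] by simp
qed

lemma weight_W_star_biorthogonality:
  assumes "m \<le> N" "n \<le> N"
  shows "(\<Sum>j=0..N. weight_W_star \<alpha> \<beta> \<zeta> N j * Utilde j m \<alpha> \<beta> \<zeta> N * Ufun j n \<alpha> \<beta> \<zeta> N)
    = norm_h_star \<alpha> \<beta> \<zeta> N n * (if n = m then 1 else 0)"
proof -
  have "(\<Sum>j=0..N. weight_W_star \<alpha> \<beta> \<zeta> N j * Utilde j m \<alpha> \<beta> \<zeta> N * Ufun j n \<alpha> \<beta> \<zeta> N)
      = (\<Sum>j\<le>N. c / h j * V j m * U j n)"
    unfolding atLeast0AtMost
    by (intro sum.cong refl)
      (simp only: weight_W_star_eq Utilde_eq_V[OF assms(1)] Ufun_eq_U atMost_iff)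
  then show ?thesis
    unfolding dual_biorthogonality[OF assms(2,1)] norm_h_star_eq by simp
qed

end

theorem proposition6:
  fixes \<alpha> \<beta> \<zeta> :: real and N m n :: nat
  assumes "N > 0"
    and "generic \<alpha> \<beta> \<zeta> N"
    and "m \<le> N" and "n \<le> N"
  shows "(\<Sum>j=0..N. weight_W \<alpha> \<beta> \<zeta> N j * Utilde m j \<alpha> \<beta> \<zeta> N * Ufun n j \<alpha> \<beta> \<zeta> N)
           = norm_h \<alpha> \<beta> \<zeta> N n * (if n = m then 1 else 0)
       \<and> (\<Sum>j=0..N. weight_W_star \<alpha> \<beta> \<zeta> N j * Utilde j m \<alpha> \<beta> \<zeta> N * Ufun j n \<alpha> \<beta> \<zeta> N)
           = norm_h_star \<alpha> \<beta> \<zeta> N n * (if n = m then 1 else 0)"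
  using weight_W_biorthogonality[OF assms(2-4)] weight_W_star_biorthogonality[OF assms(2-4)]
  by (rule conjI)

end
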